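(* Let $A:\mathbb{R}^d\to\mathbb{R}^m$ be a linear map that has no singular value of multiplicity $d-1$ or $d$, and let $(v^k)_{k\in\mathbb{N}}$ be the sequence of random variables generated by the algorithm described in the context. Let $\sigma_1=\|A\|$ be the largest singular value of $A$. Then $$\lim_{k\to\infty}\|Av^k\|=\sigma_1\quad\text{almost surely.}$$ Moreover, if the right singular space $\{x\in\mathbb{R}^d \mid A^*Ax=\sigma_1^2x\}$ is one-dimensional, then $(v^k)_{k\in\mathbb{N}}$ converges almost surely to a right singular vector of $A$ for $\sigma_1$.
   Context: $\|\cdot\|$ and $\langle\cdot,\cdot\rangle$ are the standard Euclidean norm and inner product; for a linear map, $\|A\|$ is the induced operator norm and $A^*$ the adjoint. The singular values of $A$ are the nonnegative square roots of the eigenvalues of $A^*A$ (zero included); the multiplicity of a singular value $\sigma$ is the dimension of the eigenspace of $A^*A$ for $\sigma^2$; right singular vectors are the eigenvectors of $A^*A$. Algorithm: Draw $\hat v\sim\mathcal{N}(0,I_d)$ and set $v^0=\hat v/\|\hat v\|$. For $k=0,1,2,\dots$: sample $y^k\sim\mathcal{N}(0,I_d)$ (independently of everything before); set $x^k=\dfrac{y^k-\langle y^k,v^k\rangle v^k}{\|y^k-\langle y^k,v^k\rangle v^k\|}$; set $a_k=\langle Av^k,Ax^k\rangle$ and $b_k=\|Ax^k\|^2-\|Av^k\|^2$; set $\tau_k=\operatorname{sign}(a_k)\left(\frac{b_k}{2|a_k|}+\sqrt{\frac{b_k^2}{4a_k^2}+1}\right)$; set $v^{k+1}=\dfrac{v^k+\tau_kx^k}{\sqrt{1+\tau_k^2}}$.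 The step is undefined if $a_k=0$, but under the stated multiplicity assumption this happens with probability zero, so the sequence is almost surely well defined. *)

theory Defs
  imports "HOL-Probability.Probability"
begin

section \<open>Singular values of a linear map\<close>

definition right_singular_space ::
    "(real^'n \<Rightarrow> real^'m) \<Rightarrow> real \<Rightarrow> (real^'n) set" where
  "right_singular_space A \<sigma> = {x. adjoint A (A x) = \<sigma>\<^sup>2 *\<^sub>R x}"

text \<open>The scalar 0 is a singular value exactly when \<open>A\<close> has a nontrivial kernel.\<close>

definition singular_value :: "(real^'n \<Rightarrow> real^'m) \<Rightarrow> real \<Rightarrow> bool" where
  "singular_value A \<sigma> \<longleftrightarrow> 0 \<le> \<sigma> \<and> (\<exists>x. x \<noteq> 0 \<and> adjoint A (A x) = \<sigma>\<^sup>2 *\<^sub>R x)"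

definition singular_multiplicity :: "(real^'n \<Rightarrow> real^'m) \<Rightarrow> real \<Rightarrow> nat" where
  "singular_multiplicity A \<sigma> = dim (right_singular_space A \<sigma>)"

definition right_singular_vector ::
    "(real^'n \<Rightarrow> real^'m) \<Rightarrow> real \<Rightarrow> real^'n \<Rightarrow> bool" where
  "right_singular_vector A \<sigma> x \<longleftrightarrow> x \<noteq> 0 \<and> adjoint A (A x) = \<sigma>\<^sup>2 *\<^sub>R x"


section \<open>Standard Gaussian random vectors\<close>

text \<open>The law \<open>N(0, I)\<close>, whose Lebesgue density is the product of the standard normal
  densities of the coordinates.\<close>

definition std_gaussian_vector :: "'a measure \<Rightarrow> ('a \<Rightarrow> real^'n) \<Rightarrow> bool" where
  "std_gaussian_vector M X \<longleftrightarrow>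
     distributed M lborel X (\<lambda>x. ennreal (\<Prod>i\<in>UNIV. std_normal_density (x $ i)))"


section \<open>The algorithm\<close>

text \<open>The algorithm is a deterministic function of the samples: \<open>w\<close> is the initial Gaussian
  sample and \<open>y k\<close> the sample drawn in iteration \<open>k\<close>.  Divisions by zero take Isabelle's
  default value here; \<open>run_defined\<close> below says that none occurs.\<close>

definition normal_part :: "real^'n \<Rightarrow> real^'n \<Rightarrow> real^'n" where
  "normal_part v y = y - (y \<bullet> v) *\<^sub>R v"

definition direction :: "real^'n \<Rightarrow> real^'n \<Rightarrow> real^'n" where
  "direction v y = normal_part v y /\<^sub>R norm (normal_part v y)"

definition coeff_a :: "(real^'n \<Rightarrow> real^'m) \<Rightarrow> real^'n \<Rightarrow> real^'n \<Rightarrow> real" where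
  "coeff_a A v x = A v \<bullet> A x"

definition coeff_b :: "(real^'n \<Rightarrow> real^'m) \<Rightarrow> real^'n \<Rightarrow> real^'n \<Rightarrow> real" where
  "coeff_b A v x = (norm (A x))\<^sup>2 - (norm (A v))\<^sup>2"

definition step_size :: "real \<Rightarrow> real \<Rightarrow> real" where
  "step_size a b = sgn a * (b / (2 * \<bar>a\<bar>) + sqrt (b\<^sup>2 / (4 * a\<^sup>2) + 1))"

definition alg_step :: "(real^'n \<Rightarrow> real^'m) \<Rightarrow> real^'n \<Rightarrow> real^'n \<Rightarrow> real^'n" where
  "alg_step A v y =
     (let x = direction v y;
          \<tau> = step_size (coeff_a A v x) (coeff_b A v x)
      in (v + \<tau> *\<^sub>R x) /\<^sub>R sqrt (1 + \<tau>\<^sup>2))"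

primrec iterate ::
    "(real^'n \<Rightarrow> real^'m) \<Rightarrow> real^'n \<Rightarrow> (nat \<Rightarrow> real^'n) \<Rightarrow> nat \<Rightarrow> real^'n" where
  "iterate A w y 0 = w /\<^sub>R norm w"
| "iterate A w y (Suc k) = alg_step A (iterate A w y k) (y k)"

definition run_defined ::
    "(real^'n \<Rightarrow> real^'m) \<Rightarrow> real^'n \<Rightarrow> (nat \<Rightarrow> real^'n) \<Rightarrow> bool" where
  "run_defined A w y \<longleftrightarrow> w \<noteq> 0 \<and>
     (\<forall>k. normal_part (iterate A w y k) (y k) \<noteq> 0 \<and>
          coeff_a A (iterate A w y k) (direction (iterate A w y k) (y k)) \<noteq> 0)"

end

theory Submission
  imports Defs
begin

text \<open>
  A step replaces \<open>v\<close> by a unit vector of the plane spanned by \<open>v\<close> and the sample \<open>y\<close> that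
  maximises \<open>\<parallel>A u\<parallel>\<close>.  Hence \<open>\<parallel>A v\<^sup>k\<parallel>\<close> increases, and \<open>\<parallel>A v\<^bsup>k+1\<^esup>\<parallel> \<ge> \<parallel>A y\<^sup>k\<parallel> / \<parallel>y\<^sup>k\<parallel>\<close>.
  For \<open>r < \<sigma>\<^sub>1\<close> the open cone \<open>r \<parallel>y\<parallel> < \<parallel>A y\<parallel>\<close> has positive Gaussian measure, so almost surely
  some sample hits it, which forces the limit.

  The step is defined when \<open>y\<close> is not orthogonal to \<open>A\<^sup>*A v - \<parallel>A v\<parallel>\<^sup>2 v\<close>, which is almost sure unless
  \<open>v\<close> is a singular vector.  If \<open>v\<close> is none but the next iterate lies in a singular space \<open>E\<close>, then
  \<open>y\<close> lies in the span of \<open>v\<close> and \<open>E\<close>, a proper subspace because \<open>dim E \<le> d - 2\<close>.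

  When the top singular space is a line, compactness of the sphere drives the iterates to its two
  unit vectors, and \<open>\<langle>v\<^sup>k, v\<^bsup>k+1\<^esup>\<rangle> > 0\<close> prevents them from jumping between these.
\<close>

section \<open>Singular spaces\<close>

text \<open>For a unit \<open>v\<close> this is the component of \<open>adjoint A (A v)\<close>
  orthogonal to \<open>v\<close>, that is, half the gradient of the squared norm of
  \<open>A v\<close> along the unit sphere.\<close>

definition residual :: "(real^'n \<Rightarrow> real^'m) \<Rightarrow> real^'n \<Rightarrow> real^'n" where
  "residual A v = adjoint A (A v) - (norm (A v))\<^sup>2 *\<^sub>R v"

lemma inner_residual:
  assumes "linear A"
  shows "y \<bullet> residual A v = A v \<bullet> A y - (norm (A v))\<^sup>2 * (y \<bullet> v)"
  using adjoint_works[OF assms, of y "A v"]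
  by (simp add: residual_def inner_diff_right inner_commute)

text \<open>A unit eigenvector has eigenvalue
  \<open>v \<bullet> adjoint A (A v) = (norm (A v))\<^sup>2\<close>, so only
  \<open>\<sigma> = norm (A v)\<close> is possible. This replaces a quantifier over singular values
  by a single measurable equation.\<close>

lemma residual_eq_0_iff:
  assumes "linear A" "norm v = 1"
  shows "residual A v = 0 \<longleftrightarrow> (\<exists>\<sigma>. singular_value A \<sigma> \<and> v \<in> right_singular_space A \<sigma>)"
proof
  assume "residual A v = 0"
  then have "adjoint A (A v) = (norm (A v))\<^sup>2 *\<^sub>R v"
    by (simp add: residual_def)
  then have "singular_value A (norm (A v)) \<and> v \<in> right_singular_space A (norm (A v))"
    using assms(2)
    by (auto simp: singular_value_def right_singular_space_def intro!: exI[of _ v])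
  then show "\<exists>\<sigma>. singular_value A \<sigma> \<and> v \<in> right_singular_space A \<sigma>" by blast
next
  assume "\<exists>\<sigma>. singular_value A \<sigma> \<and> v \<in> right_singular_space A \<sigma>"
  then obtain \<sigma> where eq: "adjoint A (A v) = \<sigma>\<^sup>2 *\<^sub>R v"
    by (auto simp: right_singular_space_def)
  have "(norm (A v))\<^sup>2 = v \<bullet> adjoint A (A v)"
    using adjoint_works[OF assms(1), of v "A v"] by (simp add: power2_norm_eq_inner)
  also have "\<dots> = \<sigma>\<^sup>2"
    using assms(2) by (simp add: eq dot_square_norm)
  finally show "residual A v = 0"
    by (simp add: residual_def eq)
qed

lemma subspace_right_singular_space:
  assumes "linear A"
  shows "subspace (right_singular_space A \<sigma>)"
proof -
  have "linear (adjoint A)" using assms by (rule adjoint_linear)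
  with assms show ?thesis
    by (auto simp: subspace_def right_singular_space_def linear_0 linear_add linear_cmul
        scaleR_add_right)
qed

text \<open>Eigenvectors for distinct eigenvalues are orthogonal, and
  \<open>\<sigma> \<ge> 0\<close> makes the squares of distinct singular values distinct. Finiteness
  later keeps the exceptional set a finite union of null events.\<close>

lemma finite_singular_values:
  fixes A :: "real^'n \<Rightarrow> real^'m"
  assumes "linear A"
  shows "finite {\<sigma>. singular_value A \<sigma>}"
proof -
  let ?S = "{\<sigma>. singular_value A \<sigma>}"
  obtain e where e: "\<And>\<sigma>. \<sigma> \<in> ?S \<Longrightarrow> e \<sigma> \<noteq> 0 \<and> adjoint A (A (e \<sigma>)) = \<sigma>\<^sup>2 *\<^sub>R e \<sigma>"
    using bchoice[of ?S "\<lambda>\<sigma> x. x \<noteq> 0 \<and> adjoint A (A x) = \<sigma>\<^sup>2 *\<^sub>R x"]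
    by (auto simp: singular_value_def)
  have orth: "e \<sigma> \<bullet> e \<rho> = 0" if "\<sigma> \<in> ?S" "\<rho> \<in> ?S" "\<sigma> \<noteq> \<rho>" for \<sigma> \<rho>
  proof -
    have "\<rho>\<^sup>2 * (e \<sigma> \<bullet> e \<rho>) = A (e \<sigma>) \<bullet> A (e \<rho>)"
      using adjoint_works[OF assms, of "e \<sigma>" "A (e \<rho>)"] e[OF that(2)] by simp
    also have "\<dots> = \<sigma>\<^sup>2 * (e \<sigma> \<bullet> e \<rho>)"
      using adjoint_works[OF assms, of "e \<rho>" "A (e \<sigma>)"] e[OF that(1)]
      by (simp add: inner_commute)
    finally have "e \<sigma> \<bullet> e \<rho> = 0 \<or> \<sigma>\<^sup>2 = \<rho>\<^sup>2" by auto
    moreover have "\<sigma>\<^sup>2 \<noteq> \<rho>\<^sup>2"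
      using that by (auto simp: singular_value_def power2_eq_iff_nonneg)
    ultimately show ?thesis by simp
  qed
  have inj: "inj_on e ?S"
  proof (rule inj_onI, rule ccontr)
    fix \<sigma> \<rho> assume "\<sigma> \<in> ?S" "\<rho> \<in> ?S" "e \<sigma> = e \<rho>" "\<sigma> \<noteq> \<rho>"
    then show False using orth[of \<sigma> \<rho>] e[of \<rho>] by simp
  qed
  have "pairwise orthogonal (e ` ?S)"
    using orth by (auto simp: pairwise_def orthogonal_def)
  then have "finite (e ` ?S)"
    by (rule pairwise_orthogonal_imp_finite)
  then show ?thesis
    using inj by (rule finite_imageD)
qed

section \<open>Maximisers of the norm on the sphere and sequences approaching them\<close>

text \<open>With \<open>z = adjoint A (A x)\<close> and \<open>s = onorm A\<close>, maximality gives
  \<open>x \<bullet> z = s\<^sup>2 * (norm x)\<^sup>2\<close> exactly, while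
  \<open>norm z \<le> s * s * norm x\<close>. Expanding the square of
  \<open>norm (z - s\<^sup>2 *\<^sub>R x)\<close> then leaves something nonpositive.\<close>

lemma norm_A_maximal_imp_singular:
  fixes A :: "real^'n \<Rightarrow> real^'m"
  assumes linA: "linear A" and x: "norm (A x) = onorm A * norm x"
  shows "x \<in> right_singular_space A (onorm A)"
proof -
  define s where "s = onorm A"
  define z where "z = adjoint A (A x)"
  have bl: "bounded_linear A" using linA by (simp add: linear_conv_bounded_linear)
  have zz: "norm z * norm z \<le> s * norm z * norm (A x)"
  proof -
    have "norm z * norm z = A z \<bullet> A x"
      using adjoint_works[OF linA, of z "A x"] by (simp add: z_def flip: power2_eq_square power2_norm_eq_inner)
    also have "\<dots> \<le> norm (A z) * norm (A x)" by (rule norm_cauchy_schwarz)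
    also have "\<dots> \<le> (s * norm z) * norm (A x)"
      using onorm[OF bl, of z] by (intro mult_right_mono) (auto simp: s_def)
    finally show ?thesis .
  qed
  have zle: "norm z \<le> s * s * norm x"
  proof (cases "z = 0")
    case True
    then show ?thesis by simp
  next
    case False
    have "norm z * norm z \<le> norm z * (s * s * norm x)"
      using zz x by (simp add: s_def algebra_simps)
    then show ?thesis using False by simp
  qed
  have "x \<bullet> z = (norm (A x))\<^sup>2"
    using adjoint_works[OF linA, of x "A x"] by (simp add: z_def power2_norm_eq_inner)
  then have xz: "x \<bullet> z = s\<^sup>2 * (norm x)\<^sup>2"
    using x by (simp add: s_def power_mult_distrib)
  have "(norm (z - s\<^sup>2 *\<^sub>R x))\<^sup>2 = (norm z)\<^sup>2 - 2 * s\<^sup>2 * (x \<bullet> z) + s\<^sup>2 * s\<^sup>2 * (norm x)\<^sup>2"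
    by (simp add: power2_norm_eq_inner inner_diff_left inner_diff_right inner_commute)
  also have "\<dots> = (norm z)\<^sup>2 - (s * s * norm x)\<^sup>2"
    by (simp add: xz power2_eq_square algebra_simps)
  also have "\<dots> \<le> 0"
    using power_mono[OF zle, of 2] by simp
  finally show ?thesis
    by (simp add: z_def s_def right_singular_space_def)
qed

text \<open>For a unit \<open>u\<close> spanning the top singular line, the coordinate
  \<open>c k = v k \<bullet> u\<close> has absolute value tending to 1, and its sign is eventually
  constant. The limit is \<open>u\<close> or \<open>-u\<close> accordingly.\<close>

lemma convergent_to_top_singular_vector:
  fixes A :: "real^'n \<Rightarrow> real^'m"
  assumes linA: "linear A" and dim1: "dim (right_singular_space A (onorm A)) = 1"
    and v1: "\<And>k. norm (v k) = 1"
    and pos: "\<And>k. v k \<bullet> v (Suc k) > 0"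
    and lim: "(\<lambda>k. norm (A (v k))) \<longlonglongrightarrow> onorm A"
  shows "\<exists>u. right_singular_vector A (onorm A) u \<and> v \<longlonglongrightarrow> u"
proof -
  let ?E = "right_singular_space A (onorm A)"
  have subE: "subspace ?E" by (rule subspace_right_singular_space[OF linA])
  obtain e where e: "e \<in> ?E" "e \<noteq> 0"
    using dim1 by (metis dim_eq_0 subsetI singletonI zero_neq_one)
  define u where "u = e /\<^sub>R norm e"
  have u1: "norm u = 1" and uE: "u \<in> ?E"
    using e subspace_scale[OF subE] by (simp_all add: u_def)
  have spanE: "?E \<subseteq> span {u}"
  proof (rule card_ge_dim_independent)
    show "{u} \<subseteq> ?E" using uE by simp
    show "independent {u}" using u1 by auto
    show "dim ?E \<le> card {u}" using dim1 by simp
  qed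
  define c where "c k = v k \<bullet> u" for k
  have inner: "u \<bullet> u = 1" "v j \<bullet> v j = 1" "v j \<bullet> u = c j" "u \<bullet> v j = c j" for j
    using u1 v1 by (simp_all add: c_def norm_eq_1 inner_commute)
  have cle: "\<bar>c k\<bar> \<le> 1" for k
    using Cauchy_Schwarz_ineq2[of "v k" u] v1 u1 by (simp add: c_def)
  \<comment> \<open>The part of the sphere with \<open>\<bar>x \<bullet> u\<bar> \<le> r\<close> is
    compact and contains no maximiser, so the norm of \<open>A x\<close> stays below
    \<open>onorm A\<close> there by a fixed gap. The set can be empty, for instance for negative
    \<open>r\<close>.\<close>
  have ev: "\<forall>\<^sub>F k in sequentially. \<bar>c k\<bar> > r" if r: "r < 1" for r
  proof -
    let ?K = "sphere (0 :: real^'n) 1 \<inter> {x. \<bar>x \<bullet> u\<bar> \<le> r}"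
    show ?thesis
    proof (cases "?K = {}")
      case True
      then have "\<bar>c k\<bar> > r" for k using v1[of k] by (force simp: c_def)
      then show ?thesis by simp
    next
      case False
      have "compact ?K"
        by (intro compact_Int_closed compact_sphere closed_Collect_le continuous_intros)
      moreover have "continuous_on ?K (\<lambda>x. norm (A x))"
        using linA by (intro continuous_intros linear_continuous_on)
          (simp add: linear_conv_bounded_linear)
      ultimately obtain x where x: "x \<in> ?K"
        and max: "\<And>z. z \<in> ?K \<Longrightarrow> norm (A z) \<le> norm (A x)"
        using continuous_attains_sup False by meson
      have x1: "norm x = 1" using x by simp
      have "norm (A x) \<noteq> onorm A"
      proof
        assume "norm (A x) = onorm A"
        then have "x \<in> ?E" using norm_A_maximal_imp_singular[OF linA] x1 by simp
        then obtain t where t: "x = t *\<^sub>R u" using spanE by (auto simp: span_singleton)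
        then have "\<bar>t\<bar> = 1" using x1 u1 by simp
        then have "\<bar>x \<bullet> u\<bar> = 1" using u1 by (simp add: t dot_square_norm)
        then show False using x r by simp
      qed
      moreover have "norm (A x) \<le> onorm A"
        using onorm[of A x] linA x1 by (simp add: linear_conv_bounded_linear)
      ultimately have "norm (A x) < onorm A" by simp
      with lim have "\<forall>\<^sub>F k in sequentially. norm (A (v k)) > norm (A x)"
        by (rule order_tendstoD)
      then show ?thesis
      proof eventually_elim
        case (elim k)
        then have "v k \<notin> ?K" using max[of "v k"] by linarith
        then show ?case using v1[of k] by (simp add: c_def)
      qed
    qed
  qed
  \<comment> \<open>Any threshold with square above 1/2 would do: the components along
    \<open>u\<close> must outweigh those orthogonal to \<open>u\<close>. Here a sign change would
    force \<open>v k \<bullet> v (Suc k) \<le> 4/9 - 9/16 < 0\<close>.\<close>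
  have "\<forall>\<^sub>F k in sequentially. \<bar>c k\<bar> > 3 / 4" by (rule ev) simp
  then obtain N where N: "\<And>k. k \<ge> N \<Longrightarrow> \<bar>c k\<bar> > 3 / 4"
    by (auto simp: eventually_sequentially)
  have step: "sgn (c (Suc k)) = sgn (c k)" if k: "k \<ge> N" for k
  proof (rule ccontr)
    assume "sgn (c (Suc k)) \<noteq> sgn (c k)"
    then have opp: "c k * c (Suc k) = - (\<bar>c k\<bar> * \<bar>c (Suc k)\<bar>)"
      using N[of k] N[of "Suc k"] k by (auto simp: sgn_if abs_if split: if_splits)
    have big: "\<bar>c k\<bar> * \<bar>c (Suc k)\<bar> \<ge> 9 / 16"
      using mult_mono[of "3/4" "\<bar>c k\<bar>" "3/4" "\<bar>c (Suc k)\<bar>"] N[of k] N[of "Suc k"] k by simp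
    define r where "r j = v j - c j *\<^sub>R u" for j
    have rn: "(norm (r j))\<^sup>2 = 1 - (c j)\<^sup>2" for j
      unfolding power2_norm_eq_inner r_def
      by (simp add: inner_diff_left inner_diff_right inner power2_eq_square)
    have "norm (r j) \<le> 2 / 3" if "j \<ge> N" for j
    proof (rule power2_le_imp_le)
      have "(3/4)\<^sup>2 \<le> \<bar>c j\<bar>\<^sup>2" using N[OF that] by (intro power_mono) auto
      then show "(norm (r j))\<^sup>2 \<le> (2/3)\<^sup>2" unfolding rn by (simp add: power2_eq_square)
    qed simp
    then have "norm (r k) * norm (r (Suc k)) \<le> 2 / 3 * (2 / 3)"
      using k by (intro mult_mono) auto
    then have "r k \<bullet> r (Suc k) \<le> 4 / 9"
      using norm_cauchy_schwarz[of "r k" "r (Suc k)"] by simp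
    moreover have "v k \<bullet> v (Suc k) = c k * c (Suc k) + r k \<bullet> r (Suc k)"
      by (simp add: r_def inner_diff_left inner_diff_right inner)
    ultimately show False using pos[of k] opp big by linarith
  qed
  define s where "s = sgn (c N)"
  have sk: "sgn (c k) = s" if "k \<ge> N" for k
    using that by (induction k rule: dec_induct) (auto simp: s_def step)
  have s1: "\<bar>s\<bar> = 1" using N[of N] by (auto simp: s_def sgn_if)
  have "(\<lambda>k. \<bar>c k\<bar>) \<longlonglongrightarrow> 1"
  proof (rule order_tendstoI)
    show "\<forall>\<^sub>F k in sequentially. r < \<bar>c k\<bar>" if "r < 1" for r using ev[OF that] .
    show "\<forall>\<^sub>F k in sequentially. \<bar>c k\<bar> < r" if "1 < r" for r
      using that cle by (intro always_eventually) (meson le_less_trans)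
  qed
  then have "(\<lambda>k. sqrt (2 - 2 * \<bar>c k\<bar>)) \<longlonglongrightarrow> sqrt (2 - 2 * 1)"
    by (intro tendsto_intros)
  moreover have "\<forall>\<^sub>F k in sequentially. sqrt (2 - 2 * \<bar>c k\<bar>) = norm (v k - s *\<^sub>R u)"
    unfolding eventually_sequentially
  proof (intro exI allI impI)
    fix k assume k: "N \<le> k"
    have "s * c k = \<bar>c k\<bar>" using sk[OF k] by (simp add: abs_sgn mult.commute)
    moreover have "s * s = 1" using s1 by (metis abs_mult_self_eq mult_1)
    ultimately have "(norm (v k - s *\<^sub>R u))\<^sup>2 = 2 - 2 * \<bar>c k\<bar>"
      unfolding power2_norm_eq_inner
      by (simp add: inner_diff_left inner_diff_right inner right_diff_distrib)
    then show "sqrt (2 - 2 * \<bar>c k\<bar>) = norm (v k - s *\<^sub>R u)"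
      by (metis norm_ge_zero real_sqrt_unique)
  qed
  ultimately have "(\<lambda>k. norm (v k - s *\<^sub>R u)) \<longlonglongrightarrow> sqrt (2 - 2 * 1)"
    by (rule Lim_transform_eventually)
  then have "v \<longlonglongrightarrow> s *\<^sub>R u"
    by (simp add: tendsto_norm_zero_iff LIM_zero_iff)
  moreover have "right_singular_vector A (onorm A) (s *\<^sub>R u)"
    using subspace_scale[OF subE uE, of s] u1 s1
    by (auto simp: right_singular_vector_def right_singular_space_def)
  ultimately show ?thesis by blast
qed

section \<open>One step of the algorithm\<close>

context
  fixes A :: "real^'n \<Rightarrow> real^'m" and v y x :: "real^'n" and \<tau> :: real
  assumes linA: "linear A" and v1: "norm v = 1"
    and nz: "y \<bullet> residual A v \<noteq> 0"
  defines "x \<equiv> direction v y"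
  defines "\<tau> \<equiv> step_size (coeff_a A v x) (coeff_b A v x)"
begin

text \<open>The residual is orthogonal to \<open>v\<close>, so a multiple of \<open>v\<close> would
  contradict \<open>nz\<close>.\<close>

lemma normal_part_nonzero: "normal_part v y \<noteq> 0"
proof
  assume "normal_part v y = 0"
  then have "y = (y \<bullet> v) *\<^sub>R v" by (simp add: normal_part_def)
  moreover have "v \<bullet> residual A v = 0"
    using v1 by (simp add: inner_residual[OF linA] dot_square_norm)
  ultimately show False using nz by (metis inner_scaleR_left mult_zero_right)
qed

lemma norm_direction: "norm x = 1"
  using normal_part_nonzero by (simp add: x_def direction_def)

lemma orthogonal_direction: "v \<bullet> x = 0"
  using v1 by (simp add: x_def direction_def normal_part_def inner_diff_right
      inner_commute dot_square_norm)

lemma sample_decomposition: "y = (y \<bullet> v) *\<^sub>R v + norm (normal_part v y) *\<^sub>R x"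
  using normal_part_nonzero by (simp add: x_def direction_def) (simp add: normal_part_def)

text \<open>Pairing the residual with the decomposition of \<open>y\<close> kills the part along
  \<open>v\<close> and leaves \<open>norm (normal_part v y)\<close> times the coefficient. Hence
  \<open>nz\<close> alone makes the step well defined.\<close>

lemma coeff_a_nonzero: "coeff_a A v x \<noteq> 0"
proof -
  have "y \<bullet> residual A v = norm (normal_part v y) * coeff_a A v x"
  proof -
    have "y \<bullet> residual A v = (y \<bullet> v) * (v \<bullet> residual A v)
        + norm (normal_part v y) * (x \<bullet> residual A v)"
      by (metis inner_add_left inner_scaleR_left sample_decomposition)
    moreover have "v \<bullet> residual A v = 0" "x \<bullet> residual A v = coeff_a A v x"
      using v1 orthogonal_direction
      by (simp_all add: inner_residual[OF linA] coeff_a_def dot_square_norm inner_commute)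
    ultimately show ?thesis by simp
  qed
  then show ?thesis using nz by auto
qed

text \<open>The quadratic is the stationarity condition for the direction \<open>(1, \<tau>)\<close>
  in the plane of \<open>v\<close> and \<open>x\<close>; the sign condition selects the maximum.
  With \<open>c\<close> and \<open>s\<close> as below, \<open>s\<^sup>2 = c\<^sup>2 + 1\<close>
  gives \<open>(c + s)\<^sup>2 = 2 * c * (c + s) + 1\<close>, which is the equation after
  rescaling.\<close>

lemma step_size_root:
  "coeff_a A v x * \<tau>\<^sup>2 - coeff_b A v x * \<tau> - coeff_a A v x = 0"
  "coeff_a A v x * \<tau> > 0"
proof -
  define a b where "a = coeff_a A v x" and "b = coeff_b A v x"
  have a: "a \<noteq> 0" using coeff_a_nonzero by (simp add: a_def)
  define s where "s = sqrt (b\<^sup>2 / (4 * a\<^sup>2) + 1)"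
  define c where "c = b / (2 * \<bar>a\<bar>)"
  have s2: "s\<^sup>2 = c\<^sup>2 + 1"
    using a by (simp add: s_def c_def power_divide power_mult_distrib add_nonneg_nonneg)
  have "\<bar>c\<bar> < s"
    by (rule power2_less_imp_less) (use s2 in \<open>auto simp: s_def\<close>)
  then have cs: "c + s > 0" by linarith
  have \<tau>: "\<tau> = sgn a * (c + s)"
    by (simp add: \<tau>_def step_size_def a_def b_def c_def s_def)
  have at: "a * \<tau> = \<bar>a\<bar> * (c + s)"
    unfolding \<tau> by (simp add: sgn_if)
  then show "coeff_a A v x * \<tau> > 0"
    using a cs by (simp add: a_def[symmetric])
  have b: "b = 2 * \<bar>a\<bar> * c" using a by (simp add: c_def)
  have aa: "a = sgn a * \<bar>a\<bar>" by (simp add: sgn_mult_abs)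
  have "\<tau>\<^sup>2 = (c + s)\<^sup>2" using a by (simp add: \<tau> power_mult_distrib sgn_if)
  also have "\<dots> = 2 * c * (c + s) + 1"
    using s2 by (simp add: power2_eq_square algebra_simps)
  finally have "a * \<tau>\<^sup>2 - b * \<tau> - a = a * (2 * c * (c + s)) - 2 * \<bar>a\<bar> * c * \<tau>"
    by (simp add: b algebra_simps)
  also have "\<dots> = 0"
    unfolding \<tau> by (simp add: sgn_if)
  finally show "coeff_a A v x * \<tau>\<^sup>2 - coeff_b A v x * \<tau> - coeff_a A v x = 0"
    by (simp add: a_def b_def)
qed

lemma alg_step_eq: "alg_step A v y = (v + \<tau> *\<^sub>R x) /\<^sub>R sqrt (1 + \<tau>\<^sup>2)"
  by (simp add: alg_step_def x_def \<tau>_def Let_def)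

lemma norm_combination: "(norm (\<alpha> *\<^sub>R v + \<beta> *\<^sub>R x))\<^sup>2 = \<alpha>\<^sup>2 + \<beta>\<^sup>2"
  using v1 norm_direction orthogonal_direction
  by (simp add: power2_norm_eq_inner inner_add_left inner_add_right inner_commute)
     (simp add: norm_eq_1 power2_eq_square)

lemma norm_alg_step: "norm (alg_step A v y) = 1"
proof -
  have "norm (v + \<tau> *\<^sub>R x) = sqrt (1 + \<tau>\<^sup>2)"
    using norm_combination[of 1 \<tau>] by (simp add: real_sqrt_unique)
  moreover have "1 + \<tau>\<^sup>2 > 0" by (simp add: add_pos_nonneg)
  ultimately show ?thesis by (simp add: alg_step_eq)
qed

text \<open>The inner product is \<open>1 / sqrt (1 + \<tau>\<^sup>2)\<close>, since
  \<open>x\<close> is orthogonal to \<open>v\<close>.\<close>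

lemma inner_alg_step_pos: "v \<bullet> alg_step A v y > 0"
proof -
  have "1 + \<tau>\<^sup>2 > 0" by (simp add: add_pos_nonneg)
  then show ?thesis
    using v1 orthogonal_direction by (simp add: alg_step_eq inner_add_right dot_square_norm)
qed

text \<open>The coordinates \<open>(1, \<tau>)\<close> form an eigenvector for the larger eigenvalue of the Gram matrix of
  \<open>A v\<close>, \<open>A x\<close>; that eigenvalue is \<open>\<parallel>A v\<parallel>\<^sup>2 + a \<tau>\<close>.\<close>

lemma norm_A_combination_le:
  "norm (A (\<alpha> *\<^sub>R v + \<beta> *\<^sub>R x)) \<le> norm (A (alg_step A v y)) * norm (\<alpha> *\<^sub>R v + \<beta> *\<^sub>R x)"
proof -
  define a p q where "a = coeff_a A v x" and "p = (norm (A v))\<^sup>2" and "q = (norm (A x))\<^sup>2"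
  have root: "a * \<tau>\<^sup>2 - (q - p) * \<tau> - a = 0" and pos: "a * \<tau> > 0"
    using step_size_root by (simp_all add: a_def p_def q_def coeff_b_def)
  have quad: "(norm (A (\<gamma> *\<^sub>R v + \<delta> *\<^sub>R x)))\<^sup>2 = p * \<gamma>\<^sup>2 + 2 * a * \<gamma> * \<delta> + q * \<delta>\<^sup>2" for \<gamma> \<delta>
    by (simp add: a_def p_def q_def coeff_a_def linear_add[OF linA] linear_cmul[OF linA]
        power2_norm_eq_inner inner_add_left inner_add_right inner_commute)
       (simp add: power2_eq_square algebra_simps)
  have \<tau>0: "\<tau> \<noteq> 0" using pos by auto
  have t1: "1 + \<tau>\<^sup>2 > 0" by (simp add: add_pos_nonneg)
  have "(norm (A (alg_step A v y)))\<^sup>2 = (norm (A (1 *\<^sub>R v + \<tau> *\<^sub>R x)))\<^sup>2 / (1 + \<tau>\<^sup>2)"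
    using t1 by (simp add: alg_step_eq linear_cmul[OF linA] power_divide divide_inverse
        power_mult_distrib power_inverse)
  also have "\<dots> = p + a * \<tau>"
  proof -
    have "p + 2 * a * \<tau> + q * \<tau>\<^sup>2 - (p + a * \<tau>) * (1 + \<tau>\<^sup>2)
      = - \<tau> * (a * \<tau>\<^sup>2 - (q - p) * \<tau> - a)"
      by (simp add: power2_eq_square algebra_simps)
    then have "p + 2 * a * \<tau> + q * \<tau>\<^sup>2 = (p + a * \<tau>) * (1 + \<tau>\<^sup>2)"
      using root by simp
    then show ?thesis unfolding quad using t1 by simp
  qed
  finally have lam: "(norm (A (alg_step A v y)))\<^sup>2 = p + a * \<tau>" .
  \<comment> \<open>Modulo the equation \<open>root\<close>, the slack in the desired bound is a
    positive multiple of the square of \<open>\<tau> * \<alpha> - \<beta>\<close>, which vanishes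
    along \<open>(1, \<tau>)\<close>. The factor \<open>\<tau>\<^sup>2\<close> avoids
    division.\<close>
  have "\<tau>\<^sup>2 * ((p + a * \<tau>) * (\<alpha>\<^sup>2 + \<beta>\<^sup>2) - (p * \<alpha>\<^sup>2 + 2 * a * \<alpha> * \<beta> + q * \<beta>\<^sup>2))
     - a * \<tau> * (\<tau> * \<alpha> - \<beta>)\<^sup>2 = \<tau> * \<beta>\<^sup>2 * (a * \<tau>\<^sup>2 - (q - p) * \<tau> - a)"
    by (simp add: power2_eq_square algebra_simps)
  then have "\<tau>\<^sup>2 * ((p + a * \<tau>) * (\<alpha>\<^sup>2 + \<beta>\<^sup>2) - (p * \<alpha>\<^sup>2 + 2 * a * \<alpha> * \<beta> + q * \<beta>\<^sup>2))
     = a * \<tau> * (\<tau> * \<alpha> - \<beta>)\<^sup>2"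
    using root by simp
  also have "\<dots> \<ge> 0" using pos by simp
  finally have "p * \<alpha>\<^sup>2 + 2 * a * \<alpha> * \<beta> + q * \<beta>\<^sup>2 \<le> (p + a * \<tau>) * (\<alpha>\<^sup>2 + \<beta>\<^sup>2)"
    using \<tau>0 by (simp add: zero_le_mult_iff)
  then have "(norm (A (\<alpha> *\<^sub>R v + \<beta> *\<^sub>R x)))\<^sup>2
      \<le> (norm (A (alg_step A v y)) * norm (\<alpha> *\<^sub>R v + \<beta> *\<^sub>R x))\<^sup>2"
    by (simp add: quad power_mult_distrib lam norm_combination)
  then show ?thesis by (rule power2_le_imp_le) simp
qed

lemma norm_A_alg_step_mono: "norm (A v) \<le> norm (A (alg_step A v y))"
  using norm_A_combination_le[of 1 0] v1 by simp

lemma norm_A_alg_step_ge_sample: "norm (A y) \<le> norm (A (alg_step A v y)) * norm y"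
  using norm_A_combination_le[of "y \<bullet> v" "norm (normal_part v y)"]
  by (simp flip: sample_decomposition)

text \<open>Since \<open>\<tau>\<close> is nonzero, the step can be reversed: \<open>x\<close> is a
  combination of \<open>v\<close> and the new iterate, and \<open>y\<close> one of \<open>v\<close>
  and \<open>x\<close>. A condition on the iterate thus becomes a linear one on the sample.\<close>

lemma sample_in_span:
  assumes E: "subspace E" and "alg_step A v y \<in> E"
  shows "y \<in> span (insert v E)"
proof -
  have t: "\<tau> \<noteq> 0" using step_size_root(2) by auto
  have t1: "1 + \<tau>\<^sup>2 > 0" by (simp add: add_pos_nonneg)
  have v: "v \<in> span (insert v E)" by (simp add: span_base)
  have "sqrt (1 + \<tau>\<^sup>2) *\<^sub>R alg_step A v y \<in> E"
    using E assms(2) by (rule subspace_scale)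
  then have "v + \<tau> *\<^sub>R x \<in> span (insert v E)"
    using t1 by (simp add: alg_step_eq span_base)
  then have "(v + \<tau> *\<^sub>R x) - v \<in> span (insert v E)"
    using v by (rule span_diff)
  then have "\<tau> *\<^sub>R x \<in> span (insert v E)"
    by (simp only: add_diff_cancel_left')
  then have "(1 / \<tau>) *\<^sub>R (\<tau> *\<^sub>R x) \<in> span (insert v E)"
    by (rule span_scale)
  moreover have "(1 / \<tau>) *\<^sub>R (\<tau> *\<^sub>R x) = x" using t by simp
  ultimately have "x \<in> span (insert v E)" by (simp only:)
  then show ?thesis
    by (subst sample_decomposition) (intro span_add span_scale v)
qed

end

text \<open>The one-step facts assume a unit vector, so unit norm is propagated first, by induction;
  the rest then follows at every index.\<close>

lemma iterate_invariants:
  fixes A :: "real^'n \<Rightarrow> real^'m"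
  assumes linA: "linear A" and w: "w \<noteq> 0"
    and y: "\<And>k. y k \<bullet> residual A (iterate A w y k) \<noteq> 0"
  shows "norm (iterate A w y k) = 1"
    and "run_defined A w y"
    and "iterate A w y k \<bullet> iterate A w y (Suc k) > 0"
    and "norm (A (iterate A w y k)) \<le> norm (A (iterate A w y (Suc k)))"
    and "norm (A (y k)) \<le> norm (A (iterate A w y (Suc k))) * norm (y k)"
proof -
  have n1: "norm (iterate A w y k) = 1" for k
    by (induction k) (simp_all add: w norm_alg_step[OF linA _ y])
  show "norm (iterate A w y k) = 1" by (rule n1)
  show "run_defined A w y"
    unfolding run_defined_def
    using w normal_part_nonzero[OF linA n1 y] coeff_a_nonzero[OF linA n1 y] by blast
  show "iterate A w y k \<bullet> iterate A w y (Suc k) > 0"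
    using inner_alg_step_pos[OF linA n1 y] by simp
  show "norm (A (iterate A w y k)) \<le> norm (A (iterate A w y (Suc k)))"
    using norm_A_alg_step_mono[OF linA n1 y] by simp
  show "norm (A (y k)) \<le> norm (A (iterate A w y (Suc k))) * norm (y k)"
    using norm_A_alg_step_ge_sample[OF linA n1 y] by simp
qed

section \<open>Gaussian vectors and independence\<close>

text \<open>The Gaussian law has a Lebesgue density, and proper subspaces are Lebesgue null.\<close>

lemma AE_std_gaussian_notin_subspace:
  fixes X :: "'a \<Rightarrow> real^'n"
  assumes X: "std_gaussian_vector M X" and S: "subspace S" "dim S < CARD('n)"
  shows "AE \<omega> in M. X \<omega> \<notin> S"
proof -
  let ?g = "\<lambda>x :: real^'n. ennreal (\<Prod>i\<in>UNIV. std_normal_density (x $ i))"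
  have D: "distributed M lborel X ?g"
    using X by (simp add: std_gaussian_vector_def)
  have Sm: "S \<in> sets lborel"
    using closed_subspace[OF S(1)] by simp
  have "negligible S"
    using S(2) by (intro negligible_lowdim) simp
  then have "S \<in> null_sets lborel"
    using Sm by (simp add: negligible_iff_null_sets null_sets_completion_iff)
  then have "AE x in lborel. x \<notin> S" by (rule AE_not_in)
  then have "AE x in distr M lborel X. x \<notin> S"
    using D by (subst distributed_distr_eq_density[OF D], subst AE_density)
       (auto simp: distributed_borel_measurable[OF D])
  then show ?thesis
    by (rule AE_distrD[OF distributed_measurable[OF D]])
qed

text \<open>The density is strictly positive everywhere, so a Gaussian null open set would be
  Lebesgue null, hence empty.\<close>

lemma emeasure_std_gaussian_open_pos:
  fixes X :: "'a \<Rightarrow> real^'n"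
  assumes X: "std_gaussian_vector M X" and U: "open U" "U \<noteq> {}"
  shows "emeasure M (X -` U \<inter> space M) \<noteq> 0"
proof
  let ?g = "\<lambda>x :: real^'n. ennreal (\<Prod>i\<in>UNIV. std_normal_density (x $ i))"
  assume 0: "emeasure M (X -` U \<inter> space M) = 0"
  have D: "distributed M lborel X ?g"
    using X by (simp add: std_gaussian_vector_def)
  have Um: "U \<in> sets lborel" using U(1) by simp
  have pos: "?g x \<noteq> 0" for x
  proof -
    have "(\<Prod>i\<in>UNIV. std_normal_density (x $ i)) > 0"
      by (intro prod_pos) (simp add: normal_density_pos)
    then show ?thesis by (simp only: ennreal_eq_0_iff not_le)
  qed
  have "(\<integral>\<^sup>+x. ?g x * indicator U x \<partial>lborel) = 0"
    using distributed_emeasure[OF D Um] 0 by simp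
  then have "AE x in lborel. ?g x * indicator U x = 0"
    by (subst (asm) nn_integral_0_iff_AE)
       (use Um distributed_borel_measurable[OF D] in auto)
  then have "AE x in lborel. x \<notin> U"
    using pos by (auto simp: indicator_def)
  then have "U \<in> null_sets lborel"
    using Um by (simp add: AE_iff_null_sets)
  then have "negligible U"
    using Um by (simp add: negligible_iff_null_sets null_sets_completion_iff)
  then show False
    using U open_not_negligible by blast
qed

section \<open>Two consequences of independence\<close>

text \<open>Fubini: the joint law is the product of the marginals, so \<open>X\<close> may be frozen
  at each of its values. The iterate will be \<open>X\<close> and the fresh sample
  \<open>Y\<close>.\<close>

lemma (in prob_space) AE_indep_var:
  assumes ind: "indep_var S X T Y"
    and meas: "{p \<in> space (S \<Otimes>\<^sub>M T). P (fst p) (snd p)} \<in> sets (S \<Otimes>\<^sub>M T)"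
    and ae: "\<And>x. x \<in> space S \<Longrightarrow> AE \<omega> in M. P x (Y \<omega>)"
  shows "AE \<omega> in M. P (X \<omega>) (Y \<omega>)"
proof -
  have X: "random_variable S X" and Y: "random_variable T Y"
    and eq: "distr M S X \<Otimes>\<^sub>M distr M T Y = distr M (S \<Otimes>\<^sub>M T) (\<lambda>\<omega>. (X \<omega>, Y \<omega>))"
    using ind by (simp_all add: indep_var_distribution_eq)
  interpret X: prob_space "distr M S X" using X by (rule prob_space_distr)
  interpret Y: prob_space "distr M T Y" using Y by (rule prob_space_distr)
  interpret XY: pair_sigma_finite "distr M S X" "distr M T Y" ..
  have sec: "{y \<in> space T. P x y} \<in> sets T" if "x \<in> space S" for x
  proof -
    have "Pair x -` {p \<in> space (S \<Otimes>\<^sub>M T). P (fst p) (snd p)} \<in> sets T"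
      using meas by (rule sets_Pair1)
    also have "Pair x -` {p \<in> space (S \<Otimes>\<^sub>M T). P (fst p) (snd p)} = {y \<in> space T. P x y}"
      using that by (auto simp: space_pair_measure)
    finally show ?thesis .
  qed
  have "AE x in distr M S X. AE y in distr M T Y. P x y"
    by (rule AE_I2) (use ae sec in \<open>simp add: AE_distr_iff[OF Y]\<close>)
  moreover have "{p \<in> space (distr M S X \<Otimes>\<^sub>M distr M T Y). P (fst p) (snd p)}
      \<in> sets (distr M S X \<Otimes>\<^sub>M distr M T Y)"
    using meas by (simp add: eq)
  ultimately have "AE p in distr M S X \<Otimes>\<^sub>M distr M T Y. P (fst p) (snd p)"
    by (simp add: XY.AE_pair_iff)
  then have "AE p in distr M (S \<Otimes>\<^sub>M T) (\<lambda>\<omega>. (X \<omega>, Y \<omega>)). P (fst p) (snd p)"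
    by (simp only: eq)
  from AE_distrD[OF measurable_Pair[OF X Y] this] show ?thesis by simp
qed

text \<open>Missing \<open>C\<close> at \<open>n\<close> chosen indices has probability at most
  \<open>(1 - p) ^ n\<close>, which tends to 0. A single hit is enough for the application.\<close>

lemma (in prob_space) AE_indep_vars_hit:
  fixes Y :: "nat \<Rightarrow> 'a \<Rightarrow> 'b"
  assumes ind: "indep_vars (\<lambda>_. N) Y I" and I: "infinite I" and C: "C \<in> sets N"
    and p: "p > 0" "\<And>k. k \<in> I \<Longrightarrow> prob (Y k -` C \<inter> space M) \<ge> p"
  shows "AE \<omega> in M. \<exists>k\<in>I. Y k \<omega> \<in> C"
proof -
  have Ym [measurable]: "Y k \<in> measurable M N" if "k \<in> I" for k
    using ind that by (auto simp: indep_vars_def)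
  define B where "B = (\<Inter>k\<in>I. Y k -` (space N - C) \<inter> space M)"
  have I0: "I \<noteq> {}" using I by auto
  have miss: "Y k -` (space N - C) \<inter> space M \<in> events" if "k \<in> I" for k
    using C that by (intro measurable_sets[OF Ym]) auto
  then have Bm: "B \<in> events"
    unfolding B_def using I0 by (intro sets.countable_INT') auto
  \<comment> \<open>Positivity of \<open>n\<close> makes the index set \<open>J\<close> nonempty, as
    the product formula for independent events requires; the limit below therefore starts at
    1.\<close>
  have le: "prob B \<le> (1 - p) ^ n" if "n > 0" for n
  proof -
    obtain J where J: "finite J" "card J = n" "J \<subseteq> I"
      using infinite_arbitrarily_large[OF I] by blast
    have J0: "J \<noteq> {}" using J that by auto
    have "prob B \<le> prob (\<Inter>k\<in>J. Y k -` (space N - C) \<inter> space M)"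
    proof (rule finite_measure_mono)
      show "(\<Inter>k\<in>J. Y k -` (space N - C) \<inter> space M) \<in> events"
        using J J0 miss by (intro sets.finite_INT) auto
    qed (use J(3) in \<open>auto simp: B_def\<close>)
    also have "\<dots> = (\<Prod>k\<in>J. prob (Y k -` (space N - C) \<inter> space M))"
      using C J J0 by (intro indep_varsD[OF ind]) auto
    also have "\<dots> \<le> (\<Prod>k\<in>J. 1 - p)"
    proof (intro prod_mono conjI)
      fix k assume "k \<in> J"
      then have k: "k \<in> I" using J by auto
      have "Y k -` (space N - C) \<inter> space M = space M - (Y k -` C \<inter> space M)"
        using measurable_space[OF Ym[OF k]] by auto
      then show "prob (Y k -` (space N - C) \<inter> space M) \<le> 1 - p"
        using p(2)[OF k] measurable_sets[OF Ym[OF k] C] by (simp add: prob_compl)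
    qed simp
    finally show ?thesis using J by simp
  qed
  have p1: "p \<le> 1" using p(2) I0 prob_le_1 order_trans by blast
  have "(\<lambda>n. (1 - p) ^ n) \<longlonglongrightarrow> 0"
    using p p1 by (intro LIMSEQ_realpow_zero) auto
  then have "prob B \<le> 0"
    by (rule LIMSEQ_le_const) (use le in \<open>auto intro!: exI[of _ 1]\<close>)
  then have "B \<in> null_sets M"
    using Bm by (simp add: measure_le_0_iff emeasure_eq_measure null_sets_def)
  then have "AE \<omega> in M. \<omega> \<notin> B" by (rule AE_not_in)
  then show ?thesis
    by (rule AE_mp) (use I0 in \<open>auto simp: B_def dest: measurable_space[OF Ym] intro!: AE_I2\<close>)
qed

section \<open>Almost sure behaviour\<close>

lemma measurable_linear:
  fixes f :: "'b::euclidean_space \<Rightarrow> 'c::euclidean_space"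
  assumes "linear f"
  shows "f \<in> borel_measurable borel"
  using assms by (intro borel_measurable_continuous_onI linear_continuous_on)
    (simp add: linear_conv_bounded_linear)

lemma measurable_residual:
  fixes A :: "real^'n \<Rightarrow> real^'m"
  assumes "linear A"
  shows "residual A \<in> borel_measurable borel"
proof -
  have [measurable]: "A \<in> borel_measurable borel" "adjoint A \<in> borel_measurable borel"
    using assms adjoint_linear by (blast intro: measurable_linear)+
  show ?thesis unfolding residual_def[abs_def] by measurable
qed

lemma measurable_alg_step:
  fixes A :: "real^'n \<Rightarrow> real^'m"
  assumes "linear A"
  shows "(\<lambda>p. alg_step A (fst p) (snd p)) \<in> borel_measurable (borel \<Otimes>\<^sub>M borel)"
proof -
  have [measurable]: "A \<in> borel_measurable borel"
    using assms by (rule measurable_linear)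
  show ?thesis
    unfolding alg_step_def Let_def direction_def normal_part_def coeff_a_def coeff_b_def
      step_size_def by measurable
qed

text \<open>Coordinate 0 of \<open>f\<close> is the initial sample and coordinate
  \<open>Suc i\<close> the sample of iteration \<open>i\<close>, matching
  \<open>case_nat w y\<close>. The bound \<open>k\<close> is fixed so that the induction on
  \<open>j\<close> stays in one product space.\<close>

lemma measurable_iterate:
  fixes A :: "real^'n \<Rightarrow> real^'m"
  assumes linA: "linear A" and "j \<le> k"
  shows "(\<lambda>f. iterate A (f 0) (\<lambda>i. f (Suc i)) j) \<in> borel_measurable (PiM {..k} (\<lambda>_. borel))"
  using assms(2)
proof (induction j)
  case 0
  have [measurable]: "(\<lambda>f. f 0) \<in> measurable (PiM {..k} (\<lambda>_. borel)) borel"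
    by (rule measurable_component_singleton) simp
  show ?case by simp
next
  case (Suc j)
  have 1: "(\<lambda>f. f (Suc j)) \<in> measurable (PiM {..k} (\<lambda>_. borel)) borel"
    by (rule measurable_component_singleton) (use Suc.prems in simp)
  have 2: "(\<lambda>f. iterate A (f 0) (\<lambda>i. f (Suc i)) j) \<in> borel_measurable (PiM {..k} (\<lambda>_. borel))"
    using Suc by simp
  show ?case
    using measurable_compose[OF measurable_Pair[OF 2 1] measurable_alg_step[OF linA]] by simp
qed

lemma iterate_cong:
  "(\<And>i. i < k \<Longrightarrow> y i = y' i) \<Longrightarrow> iterate A w y k = iterate A w y' k"
  by (induction k) simp_all

section \<open>Almost sure genericity of the run\<close>

text \<open>The second conjunct restores the hypothesis on \<open>v\<close> for the next step. The
  sample only has to avoid the hyperplane orthogonal to the residual and finitely many spans, each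
  of dimension at most one more than a singular space.\<close>

lemma AE_generic_step:
  fixes A :: "real^'n \<Rightarrow> real^'m"
  assumes linA: "linear A"
    and mult: "\<And>\<sigma>. singular_value A \<sigma> \<Longrightarrow> singular_multiplicity A \<sigma> + 1 < CARD('n)"
    and Y: "std_gaussian_vector M Y"
    and v: "norm v = 1" "residual A v \<noteq> 0"
  shows "AE \<omega> in M. Y \<omega> \<bullet> residual A v \<noteq> 0 \<and> residual A (alg_step A v (Y \<omega>)) \<noteq> 0"
proof -
  have 1: "AE \<omega> in M. Y \<omega> \<bullet> residual A v \<noteq> 0"
  proof -
    have "AE \<omega> in M. Y \<omega> \<notin> {x. residual A v \<bullet> x = 0}"
      using v(2) by (intro AE_std_gaussian_notin_subspace[OF Y] subspace_hyperplane)
        (simp add: dim_hyperplane)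
    then show ?thesis by (simp add: inner_commute)
  qed
  have "AE \<omega> in M. \<forall>\<sigma>\<in>{\<sigma>. singular_value A \<sigma>}.
      Y \<omega> \<notin> span (insert v (right_singular_space A \<sigma>))"
  proof (rule AE_finite_allI[OF finite_singular_values[OF linA]])
    fix \<sigma> assume "\<sigma> \<in> {\<sigma>. singular_value A \<sigma>}"
    then have "dim (right_singular_space A \<sigma>) + 1 < CARD('n)"
      using mult by (simp add: singular_multiplicity_def)
    then have "dim (span (insert v (right_singular_space A \<sigma>))) < CARD('n)"
      by (simp add: dim_insert)
    then show "AE \<omega> in M. Y \<omega> \<notin> span (insert v (right_singular_space A \<sigma>))"
      by (intro AE_std_gaussian_notin_subspace[OF Y] subspace_span)
  qed
  with 1 show ?thesis
  proof eventually_elim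
    case (elim \<omega>)
    have "norm (alg_step A v (Y \<omega>)) = 1"
      by (rule norm_alg_step[OF linA v(1) elim(1)])
    moreover have "alg_step A v (Y \<omega>) \<notin> right_singular_space A \<sigma>" if "singular_value A \<sigma>" for \<sigma>
      using sample_in_span[OF linA v(1) elim(1) subspace_right_singular_space[OF linA]]
        elim(2) that by auto
    ultimately show ?case
      using elim(1) residual_eq_0_iff[OF linA] by blast
  qed
qed

lemma AE_generic_start:
  fixes A :: "real^'n \<Rightarrow> real^'m"
  assumes linA: "linear A"
    and mult: "\<And>\<sigma>. singular_value A \<sigma> \<Longrightarrow> singular_multiplicity A \<sigma> < CARD('n)"
    and W: "std_gaussian_vector M W"
  shows "AE \<omega> in M. W \<omega> \<noteq> 0 \<and> residual A (W \<omega> /\<^sub>R norm (W \<omega>)) \<noteq> 0"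
proof -
  have "AE \<omega> in M. W \<omega> \<notin> {0}"
    by (rule AE_std_gaussian_notin_subspace[OF W]) (simp_all add: subspace_0)
  moreover have "AE \<omega> in M. \<forall>\<sigma>\<in>{\<sigma>. singular_value A \<sigma>}. W \<omega> \<notin> right_singular_space A \<sigma>"
    using mult by (intro AE_finite_allI[OF finite_singular_values[OF linA]]
        AE_std_gaussian_notin_subspace[OF W] subspace_right_singular_space[OF linA])
      (simp add: singular_multiplicity_def)
  ultimately show ?thesis
  proof eventually_elim
    case (elim \<omega>)
    have "W \<omega> /\<^sub>R norm (W \<omega>) \<notin> right_singular_space A \<sigma>" if "singular_value A \<sigma>" for \<sigma>
      using subspace_scale[OF subspace_right_singular_space[OF linA], of _ \<sigma> "norm (W \<omega>)"]
        elim that by fastforce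
    moreover have "norm (W \<omega> /\<^sub>R norm (W \<omega>)) = 1" using elim by simp
    ultimately show ?case
      using elim(1) residual_eq_0_iff[OF linA] by blast
  qed
qed

text \<open>The iterate reads only coordinates up to \<open>k\<close> of
  \<open>case_nat w y\<close>, whereas \<open>y k\<close> is coordinate \<open>Suc k\<close>;
  functions of disjoint blocks are independent.\<close>

lemma (in prob_space) indep_iterate_sample:
  fixes A :: "real^'n \<Rightarrow> real^'m"
  assumes linA: "linear A"
    and ind: "indep_vars (\<lambda>_. borel) (case_nat w y) UNIV"
  shows "indep_var borel (\<lambda>\<omega>. iterate A (w \<omega>) (\<lambda>j. y j \<omega>) k) borel (y k)"
proof -
  let ?f = "\<lambda>f. iterate A (f 0) (\<lambda>i. f (Suc i)) k"
  let ?Z = "\<lambda>\<omega> i. (case_nat w y :: nat \<Rightarrow> _) i \<omega>"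
  have "indep_var (PiM {..k} (\<lambda>_. borel)) (\<lambda>\<omega>. restrict (?Z \<omega>) {..k})
      (PiM {Suc k} (\<lambda>_. borel)) (\<lambda>\<omega>. restrict (?Z \<omega>) {Suc k})"
    by (rule indep_var_restrict[OF ind]) auto
  then have "indep_var borel (?f \<circ> (\<lambda>\<omega>. restrict (?Z \<omega>) {..k}))
      borel ((\<lambda>f. f (Suc k)) \<circ> (\<lambda>\<omega>. restrict (?Z \<omega>) {Suc k}))"
    by (rule indep_var_compose)
       (auto intro: measurable_iterate[OF linA] measurable_component_singleton)
  \<comment> \<open>The restricted family is \<open>undefined\<close> beyond index \<open>k\<close>,
    which iterate \<open>k\<close> never reads.\<close>
  moreover have "?f \<circ> (\<lambda>\<omega>. restrict (?Z \<omega>) {..k}) = (\<lambda>\<omega>. iterate A (w \<omega>) (\<lambda>j. y j \<omega>) k)"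
    by (auto simp: fun_eq_iff intro!: iterate_cong)
  moreover have "(\<lambda>f. f (Suc k)) \<circ> (\<lambda>\<omega>. restrict (?Z \<omega>) {Suc k}) = y k"
    by (simp add: fun_eq_iff)
  ultimately show ?thesis by simp
qed

lemma (in prob_space) AE_generic_run:
  fixes A :: "real^'n \<Rightarrow> real^'m"
  assumes linA: "linear A"
    and mult: "\<And>\<sigma>. singular_value A \<sigma> \<Longrightarrow> singular_multiplicity A \<sigma> + 1 < CARD('n)"
    and w: "std_gaussian_vector M w" and y: "\<And>k. std_gaussian_vector M (y k)"
    and ind: "indep_vars (\<lambda>_. borel) (case_nat w y) UNIV"
  shows "AE \<omega> in M. w \<omega> \<noteq> 0 \<and>
    (\<forall>k. y k \<omega> \<bullet> residual A (iterate A (w \<omega>) (\<lambda>j. y j \<omega>) k) \<noteq> 0)"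
proof -
  let ?v = "\<lambda>\<omega>. iterate A (w \<omega>) (\<lambda>j. y j \<omega>)"
  \<comment> \<open>Written as an implication, because \<open>AE_indep_var\<close> asks for the
    almost sure claim at every frozen \<open>v\<close>, including singular vectors. The premise is
    discharged afterwards, outcome by outcome, by induction on \<open>k\<close>.\<close>
  let ?P = "\<lambda>v y. norm v = 1 \<and> residual A v \<noteq> 0 \<longrightarrow>
    y \<bullet> residual A v \<noteq> 0 \<and> residual A (alg_step A v y) \<noteq> 0"
  have [measurable]: "residual A \<in> borel_measurable borel"
    "(\<lambda>p. alg_step A (fst p) (snd p)) \<in> borel_measurable (borel \<Otimes>\<^sub>M borel)"
    using linA by (rule measurable_residual measurable_alg_step)+
  have "AE \<omega> in M. \<forall>k. ?P (?v \<omega> k) (y k \<omega>)"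
    unfolding AE_all_countable
  proof
    fix k
    show "AE \<omega> in M. ?P (?v \<omega> k) (y k \<omega>)"
    proof (rule AE_indep_var[OF indep_iterate_sample[OF linA ind]])
      show "{p \<in> space (borel \<Otimes>\<^sub>M borel). ?P (fst p) (snd p)} \<in> sets (borel \<Otimes>\<^sub>M borel)"
        by measurable
      fix v :: "real^'n"
      show "AE \<omega> in M. ?P v (y k \<omega>)"
      proof (cases "norm v = 1 \<and> residual A v \<noteq> 0")
        case True
        then show ?thesis using AE_generic_step[OF linA mult y, of v] by simp
      qed simp
    qed
  qed
  moreover have "AE \<omega> in M. w \<omega> \<noteq> 0 \<and> residual A (w \<omega> /\<^sub>R norm (w \<omega>)) \<noteq> 0"
    using AE_generic_start[OF linA _ w] mult add_lessD1 by blast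
  ultimately show ?thesis
  proof eventually_elim
    case (elim \<omega>)
    have "norm (?v \<omega> k) = 1 \<and> residual A (?v \<omega> k) \<noteq> 0" for k
    proof (induction k)
      case 0
      then show ?case using elim(2) by simp
    next
      case (Suc k)
      then show ?case using elim(1) norm_alg_step[OF linA] by simp
    qed
    then show ?case using elim by blast
  qed
qed

text \<open>The cone is nonempty because otherwise \<open>r\<close> would bound the operator norm.
  All samples share one law, so the hitting probability of the first serves as the uniform
  \<open>p\<close>.\<close>

lemma (in prob_space) AE_sample_near_maximal:
  fixes A :: "real^'n \<Rightarrow> real^'m"
  assumes linA: "linear A" and y: "\<And>k. std_gaussian_vector M (y k)"
    and ind: "indep_vars (\<lambda>_. borel) (case_nat w y) UNIV" and r: "r < onorm A"
  shows "AE \<omega> in M. \<exists>k :: nat. r * norm (y k \<omega>) < norm (A (y k \<omega>))"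
proof -
  let ?C = "{x. r * norm x < norm (A x)}"
  have C: "open ?C"
    using linA by (intro open_Collect_less continuous_intros linear_continuous_on)
      (simp add: linear_conv_bounded_linear)
  have "?C \<noteq> {}"
  proof
    assume "?C = {}"
    then have "norm (A x) \<le> r * norm x" for x by (auto simp: not_less)
    then have "onorm A \<le> r" by (rule onorm_le)
    with r show False by simp
  qed
  with C have pos: "emeasure M (y 0 -` ?C \<inter> space M) \<noteq> 0"
    by (rule emeasure_std_gaussian_open_pos[OF y])
  have same: "emeasure M (y k -` ?C \<inter> space M) = emeasure M (y 0 -` ?C \<inter> space M)" for k
    using C by (simp only: distributed_emeasure[OF y[unfolded std_gaussian_vector_def]]
        sets_lborel borel_open)
  \<comment> \<open>The indices \<open>range Suc\<close> leave out the initial sample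
    \<open>w\<close>.\<close>
  have "AE \<omega> in M. \<exists>i\<in>range Suc. case_nat w y i \<omega> \<in> ?C"
  proof (rule AE_indep_vars_hit)
    show "indep_vars (\<lambda>_. borel) (case_nat w y) (range Suc)"
      by (rule indep_vars_subset[OF ind]) simp
    show "infinite (range Suc)" by (simp add: range_inj_infinite)
    show "?C \<in> sets borel" using C by simp
    show "prob (y 0 -` ?C \<inter> space M) > 0"
      using pos by (simp add: emeasure_eq_measure zero_less_measure_iff)
    show "prob (y 0 -` ?C \<inter> space M) \<le> prob (case_nat w y i -` ?C \<inter> space M)"
      if "i \<in> range Suc" for i
    proof -
      from \<open>i \<in> range Suc\<close> obtain k where "i = Suc k" by blast
      with same[of k] show ?thesis by (simp only: measure_def nat.case order_refl)
    qed
  qed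
  then show ?thesis by simp
qed

theorem theorem2p19:
  fixes A :: "real^'n \<Rightarrow> real^'m"
    and M :: "'a measure"
    and w :: "'a \<Rightarrow> real^'n"
    and y :: "nat \<Rightarrow> 'a \<Rightarrow> real^'n"
    and v :: "nat \<Rightarrow> 'a \<Rightarrow> real^'n"
  assumes "linear A"
    and "\<And>\<sigma>. singular_value A \<sigma> \<Longrightarrow>
           singular_multiplicity A \<sigma> \<noteq> CARD('n) - 1 \<and> singular_multiplicity A \<sigma> \<noteq> CARD('n)"
    and "prob_space M"
    and "std_gaussian_vector M w"
    and "\<And>k. std_gaussian_vector M (y k)"
    and "prob_space.indep_vars M (\<lambda>_. borel) (case_nat w y) UNIV"
    and "\<And>k \<omega>. v k \<omega> = iterate A (w \<omega>) (\<lambda>j. y j \<omega>) k"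
  shows "(AE \<omega> in M. run_defined A (w \<omega>) (\<lambda>j. y j \<omega>)) \<and>
         (AE \<omega> in M. (\<lambda>k. norm (A (v k \<omega>))) \<longlonglongrightarrow> onorm A) \<and>
         (dim (right_singular_space A (onorm A)) = 1 \<longrightarrow>
            (AE \<omega> in M. \<exists>u. right_singular_vector A (onorm A) u \<and> (\<lambda>k. v k \<omega>) \<longlonglongrightarrow> u))"
proof -
  interpret prob_space M by fact
  note linA = assms(1) and y = assms(5) and ind = assms(6) and v = assms(7)
  have bl: "bounded_linear A" using linA by (simp add: linear_conv_bounded_linear)
  have mult: "singular_multiplicity A \<sigma> + 1 < CARD('n)" if "singular_value A \<sigma>" for \<sigma>
  proof -
    have "singular_multiplicity A \<sigma> \<le> CARD('n)"
      using dim_subset_UNIV[of "right_singular_space A \<sigma>"]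
      by (simp add: singular_multiplicity_def)
    with assms(2)[OF that] show ?thesis by linarith
  qed
  have gen: "AE \<omega> in M. w \<omega> \<noteq> 0 \<and> (\<forall>k. y k \<omega> \<bullet> residual A (v k \<omega>) \<noteq> 0)"
    unfolding v by (rule AE_generic_run[OF linA mult assms(4) y ind])
  then have run: "AE \<omega> in M. run_defined A (w \<omega>) (\<lambda>j. y j \<omega>)"
    by eventually_elim (auto simp: v intro: iterate_invariants(2)[OF linA])
  \<comment> \<open>Countably many radii approaching \<open>onorm A\<close> allow one null set to
    serve for all \<open>r\<close>.\<close>
  have "AE \<omega> in M. \<forall>n. \<exists>k. (onorm A - 1 / Suc n) * norm (y k \<omega>) < norm (A (y k \<omega>))"
    unfolding AE_all_countable
    by (intro allI AE_sample_near_maximal[OF linA y ind]) simp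
  with gen have lim: "AE \<omega> in M. (\<lambda>k. norm (A (v k \<omega>))) \<longlonglongrightarrow> onorm A"
  proof eventually_elim
    case (elim \<omega>)
    have w: "w \<omega> \<noteq> 0" and g: "\<And>k. y k \<omega> \<bullet> residual A (iterate A (w \<omega>) (\<lambda>j. y j \<omega>) k) \<noteq> 0"
      using elim(1) by (auto simp: v)
    note inv = iterate_invariants[where y = "\<lambda>j. y j \<omega>", OF linA w g, folded v]
    have le: "norm (A (v k \<omega>)) \<le> onorm A" for k
      using onorm[OF bl, of "v k \<omega>"] inv(1) by simp
    have mono: "incseq (\<lambda>k. norm (A (v k \<omega>)))"
      using inv(4) by (rule incseq_SucI)
    show ?case
    proof (rule order_tendstoI)
      fix r assume "r < onorm A"
      then obtain n where n: "1 / Suc n < onorm A - r"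
        using nat_approx_posE[of "onorm A - r"] by auto
      obtain k where k: "(onorm A - 1 / Suc n) * norm (y k \<omega>) < norm (A (y k \<omega>))"
        using elim(2) by blast
      also have "\<dots> \<le> norm (A (v (Suc k) \<omega>)) * norm (y k \<omega>)" by (rule inv(5))
      finally have "onorm A - 1 / Suc n < norm (A (v (Suc k) \<omega>))"
        by (simp add: mult_less_cancel_right)
      then have "r < norm (A (v (Suc k) \<omega>))" using n by simp
      \<comment> \<open>One good sample suffices, since the norms never decrease afterwards.\<close>
      then show "\<forall>\<^sub>F k in sequentially. r < norm (A (v k \<omega>))"
        unfolding eventually_sequentially using incseqD[OF mono] less_le_trans by blast
    next
      fix r assume "onorm A < r"
      then show "\<forall>\<^sub>F k in sequentially. norm (A (v k \<omega>)) < r"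
        using le by (intro always_eventually) (meson le_less_trans)
    qed
  qed
  have "AE \<omega> in M. \<exists>u. right_singular_vector A (onorm A) u \<and> (\<lambda>k. v k \<omega>) \<longlonglongrightarrow> u"
    if "dim (right_singular_space A (onorm A)) = 1"
    using gen lim
  proof eventually_elim
    case (elim \<omega>)
    have w: "w \<omega> \<noteq> 0" and g: "\<And>k. y k \<omega> \<bullet> residual A (iterate A (w \<omega>) (\<lambda>j. y j \<omega>) k) \<noteq> 0"
      using elim(1) by (auto simp: v)
    note inv = iterate_invariants[where y = "\<lambda>j. y j \<omega>", OF linA w g, folded v]
    show ?case
      by (rule convergent_to_top_singular_vector[OF linA that inv(1,3) elim(2)])
  qed
  with run lim show ?thesis by blast
qed

end
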